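(* Let $n\ge 1$ and let $C_n$ be the cyclic anti-phase profile with shift matchings $\mu_0,\dots,\mu_{n-1}$. For $k=0,\dots,n-1$, $$E_M(\mu_k)=n(k+1),\qquad E_W(\mu_k)=n(n-k),\qquad \Delta(\mu_k)=n(2k+1-n).$$ The imbalances $\Delta(\mu_0),\dots,\Delta(\mu_{n-1})$ form the arithmetic progression $-n(n-1),\,-n(n-3),\,\dots,\,n(n-3),\,n(n-1)$ with common difference $2n$.
   Context: There are men $m_0,\dots,m_{n-1}$ and women $w_0,\dots,w_{n-1}$, each with a strict total preference order over all participants of the opposite side; a matching is a bijection $\mu$ from men to women. $r_M(m,w)$ is the rank of $w$ in $m$'s list and $r_W(w,m)$ the rank of $m$ in $w$'s list (top choice has rank $1$). Set $E_M(\mu)=\sum_m r_M(m,\mu(m))$, $E_W(\mu)=\sum_w r_W(w,\mu^{-1}(w))$, and $\Delta(\mu)=E_M(\mu)-E_W(\mu)$ (the sex-equality imbalance). The cyclic anti-phase profile $C_n$ has, with indices modulo $n$, $$m_i:\ w_i\succ w_{i+1}\succ\cdots\succ w_{i-1},\qquad w_j:\ m_{j+1}\succ m_{j+2}\succ\cdots\succ m_j.$$ For $k=0,\dots,n-1$ the shift matching $\mu_k$ is $\mu_k(m_i)=w_{i+k}$. *)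

theory Defs
  imports Main
begin

text \<open>
  Participants are indexed by \<open>{..<n}\<close> on either side. A strict total preference order over the
  opposite side is the list of all its members, most preferred first.
\<close>

definition strict_pref_list :: "nat \<Rightarrow> nat list \<Rightarrow> bool" where
  "strict_pref_list n xs \<longleftrightarrow> distinct xs \<and> set xs = {..<n}"

record profile =
  men_pref :: "nat \<Rightarrow> nat list"
  women_pref :: "nat \<Rightarrow> nat list"

definition is_profile :: "nat \<Rightarrow> profile \<Rightarrow> bool" where
  "is_profile n P \<longleftrightarrow>
     (\<forall>i<n. strict_pref_list n (men_pref P i)) \<and> (\<forall>j<n. strict_pref_list n (women_pref P j))"

text \<open>Ranks start at 1; the value is meaningful only for members of the list.\<close>

definition rank_in :: "nat list \<Rightarrow> nat \<Rightarrow> nat" where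
  "rank_in xs x = Suc (LEAST p. p < length xs \<and> xs ! p = x)"

definition rank_M :: "profile \<Rightarrow> nat \<Rightarrow> nat \<Rightarrow> nat" where
  "rank_M P m w = rank_in (men_pref P m) w"

definition rank_W :: "profile \<Rightarrow> nat \<Rightarrow> nat \<Rightarrow> nat" where
  "rank_W P w m = rank_in (women_pref P w) m"

definition is_matching :: "nat \<Rightarrow> (nat \<Rightarrow> nat) \<Rightarrow> bool" where
  "is_matching n \<mu> \<longleftrightarrow> bij_betw \<mu> {..<n} {..<n}"

definition E_M :: "nat \<Rightarrow> profile \<Rightarrow> (nat \<Rightarrow> nat) \<Rightarrow> nat" where
  "E_M n P \<mu> = (\<Sum>m<n. rank_M P m (\<mu> m))"

definition E_W :: "nat \<Rightarrow> profile \<Rightarrow> (nat \<Rightarrow> nat) \<Rightarrow> nat" where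
  "E_W n P \<mu> = (\<Sum>w<n. rank_W P w (inv_into {..<n} \<mu> w))"

definition imbalance :: "nat \<Rightarrow> profile \<Rightarrow> (nat \<Rightarrow> nat) \<Rightarrow> int" where
  "imbalance n P \<mu> = int (E_M n P \<mu>) - int (E_W n P \<mu>)"

definition cyclic_profile :: "nat \<Rightarrow> profile" where
  "cyclic_profile n =
     \<lparr> men_pref = (\<lambda>i. map (\<lambda>p. (i + p) mod n) [0..<n]),
       women_pref = (\<lambda>j. map (\<lambda>p. (j + 1 + p) mod n) [0..<n]) \<rparr>"

definition shift_matching :: "nat \<Rightarrow> nat \<Rightarrow> nat \<Rightarrow> nat" where
  "shift_matching n k i = (i + k) mod n"

lemma inj_on_shift: "inj_on (\<lambda>p. (i + p) mod n) {..<n}" for i n :: nat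
proof (rule linorder_inj_onI)
  fix x y :: nat
  assume "x < y" and *: "x \<in> {..<n}" "y \<in> {..<n}"
  show "(i + x) mod n \<noteq> (i + y) mod n"
  proof
    assume "(i + x) mod n = (i + y) mod n"
    then have "n dvd (i + y) - (i + x)"
      using \<open>x < y\<close> by (metis mod_eq_dvd_iff_nat add_le_cancel_left less_imp_le)
    then have "n dvd y - x" by simp
    with \<open>x < y\<close> * show False using nat_dvd_not_less[of "y - x" n] by auto
  qed
qed auto

lemma image_shift: "(\<lambda>p. (i + p) mod n) ` {..<n} = {..<n}" for i n :: nat
  by (rule card_subset_eq) (auto simp: card_image inj_on_shift)

lemma is_profile_cyclic_profile: "is_profile n (cyclic_profile n)"
  using inj_on_shift image_shift
  by (simp add: is_profile_def strict_pref_list_def cyclic_profile_def distinct_map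
      atLeast0LessThan flip: add_Suc)

lemma is_matching_shift_matching: "is_matching n (shift_matching n k)"
  using inj_on_shift[of k n] image_shift[of k n]
  by (simp add: is_matching_def shift_matching_def[abs_def] bij_betw_def add.commute)

end

theory Submission
  imports Defs
begin

text \<open>In a shift matching all participants of one side are equally satisfied. Under
  \<open>\<mu>_k\<close> man \<open>i\<close> gets the woman \<open>k\<close> cyclic steps after the
  head of his list, hence rank \<open>k + 1\<close> (\<open>rank_M_cyclic_shift\<close>). The list
  of woman \<open>i + k\<close> starts at man \<open>i + k + 1\<close>, and \<open>n - 1 - k\<close>
  further steps close the cycle at \<open>i\<close>, hence rank \<open>n - k\<close>
  (\<open>rank_W_cyclic_shift\<close>). Both costs are therefore sums of \<open>n\<close> equal
  terms, and the rest is arithmetic.\<close>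

lemma rank_in_nth:
  assumes "distinct xs" "p < length xs"
  shows "rank_in xs (xs ! p) = Suc p"
proof -
  have "(LEAST q. q < length xs \<and> xs ! q = xs ! p) = p"
    by (rule Least_equality) (use assms in \<open>auto simp: nth_eq_iff_index_eq\<close>)
  then show ?thesis
    by (simp add: rank_in_def)
qed

text \<open>A rotation is injective on \<open>{..<n}\<close>, so position determines rank. The free
  offset \<open>i\<close> lets this serve the men's lists and, with offset \<open>j + 1\<close>, the
  women's.\<close>

lemma rank_in_cyclic:
  assumes "p < n"
  shows "rank_in (map (\<lambda>p. (i + p) mod n) [0..<n]) ((i + p) mod n) = Suc p"
  using rank_in_nth[of "map (\<lambda>p. (i + p) mod n) [0..<n]" p] assms inj_on_shift[of i n]
  by (simp add: distinct_map atLeast0LessThan)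

lemma rank_M_cyclic_shift:
  assumes "k < n"
  shows "rank_M (cyclic_profile n) m (shift_matching n k m) = k + 1"
  using rank_in_cyclic[OF assms] by (simp add: rank_M_def cyclic_profile_def shift_matching_def)

lemma rank_W_cyclic_shift:
  assumes "k < n" "m < n"
  shows "rank_W (cyclic_profile n) (shift_matching n k m) m = n - k"
proof -
  \<comment> \<open>\<open>?p\<close> is the zero-based position of \<open>m\<close> in the list of
    \<open>?w\<close>, so the rank is \<open>Suc ?p = n - k\<close>.\<close>
  let ?w = "(m + k) mod n" and ?p = "n - 1 - k"
  have "(?w + 1 + ?p) mod n = (m + k + (1 + ?p)) mod n"
    by (simp only: add.assoc mod_add_left_eq)
  also have "m + k + (1 + ?p) = m + n"
    using assms by simp
  finally have "(?w + 1 + ?p) mod n = m"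
    using assms by simp
  then show ?thesis
    using rank_in_cyclic[of ?p n "?w + 1"] assms
    by (simp add: rank_W_def cyclic_profile_def shift_matching_def)
qed

text \<open>Reindexing along the bijection \<open>\<mu>\<close> removes \<open>inv_into\<close>, so
  no formula for the inverse shift is required.\<close>

lemma E_W_eq_sum_men:
  assumes "is_matching n \<mu>"
  shows "E_W n P \<mu> = (\<Sum>m<n. rank_W P (\<mu> m) m)"
proof -
  have bij: "bij_betw \<mu> {..<n} {..<n}"
    using assms by (simp add: is_matching_def)
  have "E_W n P \<mu> = (\<Sum>m<n. rank_W P (\<mu> m) (inv_into {..<n} \<mu> (\<mu> m)))"
    unfolding E_W_def by (rule sum.reindex_bij_betw[OF bij, symmetric])
  also have "\<dots> = (\<Sum>m<n. rank_W P (\<mu> m) m)"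
    by (rule sum.cong) (use bij in \<open>auto simp: bij_betw_def inv_into_f_f\<close>)
  finally show ?thesis .
qed

lemma E_M_cyclic_shift:
  assumes "k < n"
  shows "E_M n (cyclic_profile n) (shift_matching n k) = n * (k + 1)"
  using assms by (simp add: E_M_def rank_M_cyclic_shift)

lemma E_W_cyclic_shift:
  assumes "k < n"
  shows "E_W n (cyclic_profile n) (shift_matching n k) = n * (n - k)"
  using assms by (simp add: E_W_eq_sum_men is_matching_shift_matching rank_W_cyclic_shift)

lemma imbalance_cyclic_shift:
  assumes "k < n"
  shows "imbalance n (cyclic_profile n) (shift_matching n k) = int n * (2 * int k + 1 - int n)"
  using assms
  by (simp add: imbalance_def E_M_cyclic_shift E_W_cyclic_shift of_nat_diff algebra_simps)

theorem proposition3p6: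
  fixes n :: nat
  assumes "n \<ge> 1"
  shows "(\<forall>k<n. int (E_M n (cyclic_profile n) (shift_matching n k)) = int n * (int k + 1)
              \<and> int (E_W n (cyclic_profile n) (shift_matching n k)) = int n * (int n - int k)
              \<and> imbalance n (cyclic_profile n) (shift_matching n k) = int n * (2 * int k + 1 - int n))
       \<and> imbalance n (cyclic_profile n) (shift_matching n 0) = - (int n * (int n - 1))
       \<and> (n \<ge> 2 \<longrightarrow> imbalance n (cyclic_profile n) (shift_matching n 1) = - (int n * (int n - 3)))
       \<and> (n \<ge> 2 \<longrightarrow> imbalance n (cyclic_profile n) (shift_matching n (n - 2)) = int n * (int n - 3))
       \<and> imbalance n (cyclic_profile n) (shift_matching n (n - 1)) = int n * (int n - 1)
       \<and> (\<forall>k. k + 1 < n \<longrightarrow>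
            imbalance n (cyclic_profile n) (shift_matching n (k + 1))
              - imbalance n (cyclic_profile n) (shift_matching n k) = 2 * int n)"
  using assms
  \<comment> \<open>The bounds \<open>n \<ge> 1\<close> and \<open>n \<ge> 2\<close> keep the end
    indices below \<open>n\<close> and make \<open>n - 1\<close> and \<open>n - 2\<close> exact, so
    \<open>of_nat_diff\<close> applies.\<close>
  by (auto simp: E_M_cyclic_shift E_W_cyclic_shift imbalance_cyclic_shift of_nat_diff algebra_simps)

end
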